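(* Let $G$ be a finite, simple, connected cactus graph, i.e. every edge of $G$ belongs to at most one cycle of $G$. Then $\dim(G)\le c(G)+Z(G)$.
   Context: $\dim(G)$ is the metric dimension: the minimum size of a set $S\subseteq V(G)$ such that for every two distinct vertices $u,v$ there is $s\in S$ with $d(s,u)\neq d(s,v)$ ($d$ the shortest-path distance). $Z(G)$ is the zero forcing number: the minimum size of a set of initially black vertices such that repeatedly applying the rule "if a black vertex has exactly one white neighbor, that neighbor becomes black" eventually makes all vertices black. $c(G)=|E(G)|-|V(G)|+1$ is the cycle rank. *)

theory Defs
  imports Main
begin

text \<open>
  A graph is given by a vertex set \<open>V\<close> and a set \<open>E\<close> of undirected edges, each edge being
  the two-element set of its endpoints.
\<close>

definition finite_simple_graph :: "'a set \<Rightarrow> 'a set set \<Rightarrow> bool" where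
  "finite_simple_graph V E \<longleftrightarrow> finite V \<and> (\<forall>e\<in>E. e \<subseteq> V \<and> card e = 2)"

definition is_path :: "'a set \<Rightarrow> 'a set set \<Rightarrow> 'a \<Rightarrow> 'a list \<Rightarrow> 'a \<Rightarrow> bool" where
  "is_path V E u p v \<longleftrightarrow>
     p \<noteq> [] \<and> set p \<subseteq> V \<and> distinct p \<and> hd p = u \<and> last p = v \<and>
     successively (\<lambda>x y. {x, y} \<in> E) p"

definition connected_graph :: "'a set \<Rightarrow> 'a set set \<Rightarrow> bool" where
  "connected_graph V E \<longleftrightarrow> V \<noteq> {} \<and> (\<forall>u\<in>V. \<forall>v\<in>V. \<exists>p. is_path V E u p v)"

text \<open>
  The length of a path is its number of edges. The value is only meaningful if a path from
  \<open>u\<close> to \<open>v\<close> exists.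
\<close>

definition graph_dist :: "'a set \<Rightarrow> 'a set set \<Rightarrow> 'a \<Rightarrow> 'a \<Rightarrow> nat" where
  "graph_dist V E u v = (LEAST n. \<exists>p. is_path V E u p v \<and> n = length p - 1)"

definition cycle_edges :: "'a list \<Rightarrow> 'a set set" where
  "cycle_edges p = {{p ! i, p ! (Suc i mod length p)} | i. i < length p}"

definition is_cycle :: "'a set \<Rightarrow> 'a set set \<Rightarrow> 'a list \<Rightarrow> bool" where
  "is_cycle V E p \<longleftrightarrow> 3 \<le> length p \<and> distinct p \<and> set p \<subseteq> V \<and> cycle_edges p \<subseteq> E"

text \<open>
  A cycle is a subgraph: the lists obtained from one another by rotation and reversal describe
  the same cycle. Cycles are therefore identified by their edge sets.
\<close>

definition cactus :: "'a set \<Rightarrow> 'a set set \<Rightarrow> bool" where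
  "cactus V E \<longleftrightarrow>
     (\<forall>e\<in>E. \<forall>p q. is_cycle V E p \<and> e \<in> cycle_edges p \<and> is_cycle V E q \<and> e \<in> cycle_edges q
        \<longrightarrow> cycle_edges p = cycle_edges q)"

definition resolving_set :: "'a set \<Rightarrow> 'a set set \<Rightarrow> 'a set \<Rightarrow> bool" where
  "resolving_set V E S \<longleftrightarrow>
     S \<subseteq> V \<and>
     (\<forall>u\<in>V. \<forall>v\<in>V. u \<noteq> v \<longrightarrow> (\<exists>s\<in>S. graph_dist V E s u \<noteq> graph_dist V E s v))"

definition metric_dimension :: "'a set \<Rightarrow> 'a set set \<Rightarrow> nat" where
  "metric_dimension V E = (LEAST k. \<exists>S. resolving_set V E S \<and> card S = k)"

text \<open>One application of the colour-change rule; \<open>B\<close> is the set of black vertices.\<close>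

definition force_step :: "'a set \<Rightarrow> 'a set set \<Rightarrow> 'a set \<Rightarrow> 'a set \<Rightarrow> bool" where
  "force_step V E B B' \<longleftrightarrow>
     (\<exists>u\<in>B. \<exists>v. {w \<in> V. {u, w} \<in> E \<and> w \<notin> B} = {v} \<and> B' = insert v B)"

definition zero_forcing_set :: "'a set \<Rightarrow> 'a set set \<Rightarrow> 'a set \<Rightarrow> bool" where
  "zero_forcing_set V E S \<longleftrightarrow> S \<subseteq> V \<and> (force_step V E)\<^sup>*\<^sup>* S V"

definition zero_forcing_number :: "'a set \<Rightarrow> 'a set set \<Rightarrow> nat" where
  "zero_forcing_number V E = (LEAST k. \<exists>S. zero_forcing_set V E S \<and> card S = k)"

definition cycle_rank :: "'a set \<Rightarrow> 'a set set \<Rightarrow> int" where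
  "cycle_rank V E = int (card E) - int (card V) + 1"

end

theory Submission
  imports Defs
begin

text \<open>
  Let \<open>S\<close> be a minimum zero forcing set. Adding one suitable vertex per cycle to \<open>S\<close> yields a
  resolving set, and a cactus has at most \<open>c(G)\<close> cycles, because its cycles are edge disjoint and
  deleting one edge from each keeps the graph connected.

  In a cactus the vertices of a cycle \<open>C\<close> lie in distinct components of \<open>G - E(C)\<close>, so \<open>G\<close>
  retracts onto \<open>C\<close> by sending a vertex to its gate, the vertex of \<open>C\<close> in its component. The
  vertices whose gate is not \<open>g\<close> form a fort: only \<open>g\<close> is adjacent to them, and to two of them. As
  zero forcing sets meet all forts, \<open>S\<close> has two different gates \<open>x, y\<close> on \<open>C\<close>. There is a vertex
  \<open>t\<close> of \<open>C\<close>, the one to be added, such that \<open>{x, y, t}\<close> doubly resolves \<open>C\<close>, that is,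
  \<open>d(z, a) - d(z, b)\<close> is not constant on it for \<open>a \<noteq> b\<close>.

  If \<open>u \<noteq> v\<close> are not resolved by the enlarged set, it follows that they have the same gate on
  every cycle, so \<open>f(z) = d(z, u) - d(z, v)\<close> is constant on every cycle. Then \<open>{f \<noteq> 0}\<close> is a fort
  that misses \<open>S\<close>: if a vertex \<open>x\<close> outside it had exactly one neighbour \<open>w\<close> in it, then
  \<open>x\<close> and \<open>w\<close> would lie on a common cycle.
\<close>

section \<open>The integers modulo \<open>n\<close> as a cycle\<close>

definition doubly_resolving :: "('a \<Rightarrow> 'a \<Rightarrow> int) \<Rightarrow> 'a set \<Rightarrow> 'a set \<Rightarrow> bool" where
  "doubly_resolving \<delta> A X \<longleftrightarrow>
     (\<forall>a\<in>A. \<forall>b\<in>A. (\<exists>k. \<forall>x\<in>X. \<delta> x a - \<delta> x b = k) \<longrightarrow> a = b)"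

lemma doubly_resolving_image:
  assumes "doubly_resolving \<delta> A X" "\<And>i j. \<delta>' (f i) (f j) = \<delta> i j"
  shows "doubly_resolving \<delta>' (f ` A) (f ` X)"
  unfolding doubly_resolving_def
proof (intro ballI impI)
  fix x y assume xy: "x \<in> f ` A" "y \<in> f ` A" and "\<exists>k. \<forall>z\<in>f ` X. \<delta>' z x - \<delta>' z y = k"
  then obtain a b where ab: "a \<in> A" "b \<in> A" "x = f a" "y = f b" by blast
  with \<open>\<exists>k. _ k\<close> have "\<exists>k. \<forall>z\<in>X. \<delta> z a - \<delta> z b = k" using assms(2) by simp
  then show "x = y" using assms(1) ab unfolding doubly_resolving_def by blast
qed

lemma mod_diff_eq_if:
  fixes a b n :: int
  assumes "0 < n"
  shows "(a - b) mod n = (if b mod n \<le> a mod n then a mod n - b mod n else a mod n - b mod n + n)"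
proof -
  have bounds: "0 \<le> a mod n" "a mod n < n" "0 \<le> b mod n" "b mod n < n"
    using assms by auto
  have diff: "(a - b) mod n = (a mod n - b mod n) mod n" by (simp add: mod_simps)
  show ?thesis
  proof (cases "b mod n \<le> a mod n")
    case True
    have "(a mod n - b mod n) mod n = a mod n - b mod n"
      by (rule mod_pos_pos_trivial) (use bounds True in linarith)+
    then show ?thesis using True diff by simp
  next
    case False
    have "(a mod n - b mod n + n) mod n = a mod n - b mod n + n"
      by (rule mod_pos_pos_trivial) (use bounds False in linarith)+
    then show ?thesis using False diff by simp
  qed
qed

lemma mod_diff_pos:
  fixes a b n :: int
  assumes "0 < n" "a mod n \<noteq> b mod n"
  shows "0 < (a - b) mod n"
  using assms pos_mod_sign[of n "a - b"] mod_eq_dvd_iff[of a n b] by (auto simp: order_less_le)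

lemma mod_diff_le_half_cases:
  fixes a b n :: int
  assumes "0 < n"
  obtains "2 * ((a - b) mod n) \<le> n" | "2 * ((b - a) mod n) \<le> n"
  using zmod_zminus1_eq_if[of "a - b" n] assms by (fastforce split: if_splits)

definition cyclic_dist :: "int \<Rightarrow> int \<Rightarrow> int \<Rightarrow> int" where
  "cyclic_dist n i j = min ((i - j) mod n) ((j - i) mod n)"

lemma cyclic_dist_self [simp]: "cyclic_dist n i i = 0"
  by (simp add: cyclic_dist_def)

lemma cyclic_dist_cong:
  assumes "(i - j) mod n = (i' - j') mod n"
  shows "cyclic_dist n i j = cyclic_dist n i' j'"
proof -
  have "(j - i) mod n = (j' - i') mod n"
    using mod_minus_cong[OF assms] by simp
  then show ?thesis using assms by (simp add: cyclic_dist_def)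
qed

lemma cyclic_dist_eq_min:
  assumes "0 < n"
  shows "cyclic_dist n i j = min ((i - j) mod n) (n - (i - j) mod n)"
proof -
  have "(j - i) mod n = (if (i - j) mod n = 0 then 0 else n - (i - j) mod n)"
    using zmod_zminus1_eq_if[of "i - j" n] by simp
  then show ?thesis using pos_mod_sign[OF assms, of "i - j"] assms
    by (auto simp: cyclic_dist_def)
qed

lemma cyclic_dist_succ:
  assumes "0 < n"
  shows "\<bar>cyclic_dist n (i + 1) j - cyclic_dist n i j\<bar> \<le> 1"
proof -
  define r where "r = (i - j) mod n"
  have r: "0 \<le> r" "r < n" using assms by (auto simp: r_def)
  have "(i + 1 - j) mod n = (r + 1) mod n" by (simp add: r_def mod_simps algebra_simps)
  also have "\<dots> = (if r + 1 = n then 0 else r + 1)" using r by simp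
  finally show ?thesis
    using r unfolding cyclic_dist_eq_min[OF assms] r_def[symmetric] by (simp add: min_def)
qed

text \<open>As \<open>x\<close> moves around the cycle, \<open>d(x, a) - d(x, b)\<close> takes each value \<open>k\<close> with \<open>\<bar>k\<bar> < d(a, b)\<close>
  at most once on each of the two arcs between \<open>a\<close> and \<open>b\<close>.\<close>

lemma cyclic_dist_diff_cases:
  fixes n a b x :: int
  defines "\<alpha> \<equiv> (a - b) mod n" and "r \<equiv> (x - b) mod n"
  assumes n: "0 < n" and ab: "a mod n \<noteq> b mod n" "2 * \<alpha> \<le> n"
    and diff: "cyclic_dist n x a - cyclic_dist n x b = k"
  obtains "k = - \<alpha>" "\<alpha> \<le> r" "2 * r \<le> n"
    | "k = \<alpha>" "r = 0 \<or> n + 2 * \<alpha> \<le> 2 * r"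
    | "\<bar>k\<bar> < \<alpha>" "2 * r = \<alpha> - k \<or> 2 * r = n + \<alpha> + k"
proof -
  have \<alpha>: "0 < \<alpha>" unfolding \<alpha>_def using n ab by (intro mod_diff_pos)
  have r: "0 \<le> r" "r < n" using n by (auto simp: r_def)
  have "(x - a) mod n = (r - \<alpha>) mod n" by (simp add: r_def \<alpha>_def mod_simps)
  also have "\<dots> = (if \<alpha> \<le> r then r - \<alpha> else r - \<alpha> + n)" (is "_ = ?s")
    using mod_diff_eq_if[OF n, of r \<alpha>] r \<alpha> ab n by simp
  finally have k: "min ?s (n - ?s) - min r (n - r) = k"
    using diff by (simp add: cyclic_dist_eq_min[OF n] r_def[symmetric])
  consider "r \<le> \<alpha>" | "\<alpha> \<le> r" "2 * r \<le> n" | "n \<le> 2 * r" "2 * r \<le> n + 2 * \<alpha>" | "n + 2 * \<alpha> \<le> 2 * r"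
    by linarith
  then have "(k = - \<alpha> \<and> \<alpha> \<le> r \<and> 2 * r \<le> n) \<or> (k = \<alpha> \<and> (r = 0 \<or> n + 2 * \<alpha> \<le> 2 * r))
      \<or> (\<bar>k\<bar> < \<alpha> \<and> (2 * r = \<alpha> - k \<or> 2 * r = n + \<alpha> + k))"
    by cases (use \<alpha> ab r k in \<open>auto simp: min_def split: if_splits\<close>)
  then show ?thesis using that by blast
qed

text \<open>No arc with fewer than \<open>n / 2\<close> edges contains all of \<open>X\<close>.\<close>

definition spread :: "int \<Rightarrow> int set \<Rightarrow> bool" where
  "spread n X \<longleftrightarrow> (\<forall>c. \<exists>x\<in>X. n \<le> 2 * ((x - c) mod n))"

lemma spread_shifted:
  assumes "spread n X"
  shows "\<exists>x\<in>X. n \<le> 2 * (((x - b) mod n + m) mod n)"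
proof -
  have "(x - (b - m)) mod n = ((x - b) mod n + m) mod n" for x
    by (simp add: mod_simps algebra_simps)
  then show ?thesis using assms unfolding spread_def by metis
qed

lemma spread_imp_abs_constant_diff_less:
  assumes n: "0 < n" and "spread n X" and ab: "a mod n \<noteq> b mod n" "2 * ((a - b) mod n) \<le> n"
    and const: "\<And>x. x \<in> X \<Longrightarrow> cyclic_dist n x a - cyclic_dist n x b = k"
  shows "\<bar>k\<bar> < (a - b) mod n"
proof -
  define \<alpha> where "\<alpha> = (a - b) mod n"
  define r where "r x = (x - b) mod n" for x
  have r: "0 \<le> r x" "r x < n" for x using n by (auto simp: r_def)
  have \<alpha>: "0 < \<alpha>" "2 * \<alpha> \<le> n" using mod_diff_pos[OF n ab(1)] ab(2) by (auto simp: \<alpha>_def)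
  note cases = cyclic_dist_diff_cases[OF n ab const, folded \<alpha>_def, folded r_def]
  note far = spread_shifted[OF \<open>spread n X\<close>, of b, folded r_def]
  have "k \<noteq> - \<alpha>"
  proof
    assume k: "k = - \<alpha>"
    obtain x where x: "x \<in> X" "n \<le> 2 * ((r x - \<alpha>) mod n)" using far[of "- \<alpha>"] by auto
    have "\<alpha> \<le> r x" "2 * r x \<le> n" using x(1) k \<alpha> by (cases rule: cases; simp)+
    then show False using x(2) \<alpha> r[of x] by simp
  qed
  moreover have "k \<noteq> \<alpha>"
  proof
    assume k: "k = \<alpha>"
    define h where "h = n div 2 - \<alpha>"
    have h: "0 \<le> h" "2 * h < n" "n \<le> 2 * (h + \<alpha>) + 1" using \<alpha> by (auto simp: h_def)
    obtain x where x: "x \<in> X" "n \<le> 2 * ((r x + h) mod n)" using far[of h] by blast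
    have "r x = 0 \<or> n + 2 * \<alpha> \<le> 2 * r x" using x(1) k \<alpha> by (cases rule: cases) auto
    then show False
    proof
      assume "n + 2 * \<alpha> \<le> 2 * r x"
      then have "(r x + h - n) mod n = r x + h - n"
        using h r[of x] by (intro mod_pos_pos_trivial) auto
      then show False using x(2) r[of x] h by simp
    qed (use x(2) h in simp)
  qed
  moreover obtain x where "x \<in> X" using far by blast
  ultimately show ?thesis unfolding \<alpha>_def[symmetric] by (cases rule: cases) auto
qed

lemma spread_constant_diff_imp_card_le_2:
  assumes n: "0 < n" and "spread n X" and ab: "a mod n \<noteq> b mod n" "2 * ((a - b) mod n) \<le> n"
    and const: "\<And>x. x \<in> X \<Longrightarrow> cyclic_dist n x a - cyclic_dist n x b = k"
  shows "card ((\<lambda>x. x mod n) ` X) \<le> 2"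
proof -
  define \<alpha> where "\<alpha> = (a - b) mod n"
  let ?levels = "{(b + (\<alpha> - k) div 2) mod n, (b + (n + \<alpha> + k) div 2) mod n}"
  have "(\<lambda>x. x mod n) ` X \<subseteq> ?levels"
  proof (rule image_subsetI)
    fix x assume x: "x \<in> X"
    define r where "r = (x - b) mod n"
    have "\<bar>k\<bar> < \<alpha>" unfolding \<alpha>_def by (rule spread_imp_abs_constant_diff_less[OF assms])
    with x have "r = (\<alpha> - k) div 2 \<or> r = (n + \<alpha> + k) div 2"
      unfolding r_def \<alpha>_def by (cases rule: cyclic_dist_diff_cases[OF n ab const]) auto
    moreover have "x mod n = (b + r) mod n" by (simp add: r_def mod_simps)
    ultimately show "x mod n \<in> ?levels" by (elim disjE) simp_all
  qed
  then have "card ((\<lambda>x. x mod n) ` X) \<le> card ?levels" by (rule card_mono[rotated]) simp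
  also have "\<dots> \<le> 2" by (simp add: card_insert_if)
  finally show ?thesis .
qed

lemma spread_imp_doubly_resolving:
  assumes n: "0 < n" and spread: "spread n X" and card: "3 \<le> card ((\<lambda>x. x mod n) ` X)"
  shows "doubly_resolving (cyclic_dist n) {0..<n} X"
  unfolding doubly_resolving_def
proof (intro ballI impI, elim exE)
  fix a b k assume ab: "a \<in> {0..<n}" "b \<in> {0..<n}"
    and const: "\<forall>x\<in>X. cyclic_dist n x a - cyclic_dist n x b = k"
  show "a = b"
  proof (rule ccontr)
    assume "a \<noteq> b"
    then have ne: "a mod n \<noteq> b mod n" using ab by simp
    show False
    proof (cases rule: mod_diff_le_half_cases[OF n, of a b])
      case 1
      then show False
        using spread_constant_diff_imp_card_le_2[OF n spread ne, of k] const card by simp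
    next
      case 2
      moreover have "cyclic_dist n x b - cyclic_dist n x a = - k" if "x \<in> X" for x
        using bspec[OF const that] by simp
      ultimately show False
        using spread_constant_diff_imp_card_le_2[OF n spread ne[symmetric], of "- k"] card by simp
    qed
  qed
qed

lemma spread_if_gaps_le_half:
  assumes q: "0 < q" "2 * q \<le> n" and g: "0 < g" "2 * g \<le> n"
    and rest: "q + g < n" "n \<le> 2 * (q + g)"
  shows "spread n {P, P + q, P + q + g}"
  unfolding spread_def
proof
  fix c
  define s where "s = (c - P) mod n"
  have n: "0 < n" using q by simp
  then have s: "0 \<le> s" "s < n" by (auto simp: s_def)
  have offset: "(P + r - c) mod n = (if s \<le> r then r - s else r - s + n)" if "0 \<le> r" "r < n" for r
  proof -
    have "(P + r - c) mod n = (r - s) mod n" by (simp add: s_def mod_simps algebra_simps)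
    then show ?thesis using mod_diff_eq_if[OF n, of r s] that s by simp
  qed
  have "n \<le> 2 * ((P - c) mod n)" if "0 < s" "s \<le> q" using offset[of 0] that q n by simp
  moreover have "n \<le> 2 * ((P + q - c) mod n)" if "q < s" "s \<le> q + g"
    using offset[of q] that q g rest by simp
  moreover have "n \<le> 2 * ((P + q + g - c) mod n)" if "s = 0 \<or> q + g < s"
    using offset[of "q + g"] that q g rest s by (auto simp: algebra_simps)
  ultimately show "\<exists>x\<in>{P, P + q, P + q + g}. n \<le> 2 * ((x - c) mod n)"
    using s by (metis insertCI linorder_not_le order_le_less)
qed

text \<open>The third point halves the longer of the two arcs between the given ones.\<close>

lemma spread_insert_midpoint:
  assumes n: "3 \<le> n" and PQ: "P mod n \<noteq> Q mod n" "2 * ((Q - P) mod n) \<le> n"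
  shows "\<exists>t. spread n {P, Q, t} \<and> t mod n \<noteq> P mod n \<and> t mod n \<noteq> Q mod n"
proof -
  define q where "q = (Q - P) mod n"
  define g where "g = (n - q) div 2"
  have q: "0 < q" "2 * q \<le> n"
    using mod_diff_pos[of n Q P] n PQ by (auto simp: q_def)
  have "n - q - 1 \<le> 2 * g" "2 * g \<le> n - q" unfolding g_def by linarith+
  then have g: "0 < g" "2 * g \<le> n" "q + g < n" "n \<le> 2 * (q + g)"
    using q n by auto
  have Q: "Q mod n = (P + q) mod n" by (simp add: q_def mod_simps)
  have "spread n {P, P + q, P + q + g}" by (rule spread_if_gaps_le_half[OF q g])
  then have "spread n {P, Q, P + q + g}"
    using mod_diff_cong[OF Q refl] unfolding spread_def by simp
  moreover have "(P + q + g) mod n \<noteq> P mod n"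
    using q g by (simp add: mod_eq_dvd_iff zdvd_not_zless)
  moreover have "(P + q + g) mod n \<noteq> Q mod n"
    using g q unfolding Q by (simp add: mod_eq_dvd_iff zdvd_not_zless)
  ultimately show ?thesis by blast
qed

lemma doubly_resolving_insert_third:
  assumes n: "3 \<le> n" and PQ: "P mod n \<noteq> Q mod n"
  shows "\<exists>t. doubly_resolving (cyclic_dist n) {0..<n} {P, Q, t}"
proof -
  have "0 < n" using n by simp
  then have "\<exists>t. spread n {P, Q, t} \<and> t mod n \<noteq> P mod n \<and> t mod n \<noteq> Q mod n"
  proof (cases rule: mod_diff_le_half_cases[of n Q P])
    case 1
    then show ?thesis using spread_insert_midpoint n PQ by blast
  next
    case 2
    then show ?thesis
      using spread_insert_midpoint[of n Q P] n PQ by (metis insert_commute)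
  qed
  then obtain t where t: "spread n {P, Q, t}" "t mod n \<noteq> P mod n" "t mod n \<noteq> Q mod n"
    by blast
  have "card ((\<lambda>x. x mod n) ` {P, Q, t}) = 3" using t PQ by (simp add: card_insert_if)
  then have "doubly_resolving (cyclic_dist n) {0..<n} {P, Q, t}"
    using spread_imp_doubly_resolving[OF _ t(1)] n by simp
  then show ?thesis ..
qed

section \<open>Paths and cycles\<close>

abbreviation adj :: "'a set set \<Rightarrow> 'a \<Rightarrow> 'a \<Rightarrow> bool" where
  "adj F \<equiv> \<lambda>x y. {x, y} \<in> F"

abbreviation reachable :: "'a set set \<Rightarrow> 'a \<Rightarrow> 'a \<Rightarrow> bool" where
  "reachable F \<equiv> (adj F)\<^sup>*\<^sup>*"

lemma reachable_sym: "reachable F x y \<Longrightarrow> reachable F y x"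
  by (rule sympD[OF symp_rtranclp]) (auto intro: sympI simp: insert_commute)

lemma relpowp_adj_sym: "(adj F ^^ n) x y \<Longrightarrow> (adj F ^^ n) y x"
proof (induction n arbitrary: x)
  case (Suc n)
  from Suc.prems obtain z where z: "adj F x z" "(adj F ^^ n) z y" by (rule relpowp_Suc_E2)
  then have "adj F z x" by (simp add: insert_commute)
  then show ?case by (rule relpowp_Suc_I[OF Suc.IH[OF z(2)]])
qed simp

lemma successively_adj_subset_Union:
  "successively (adj F) (x # xs) \<Longrightarrow> set xs \<subseteq> \<Union> F"
  by (induction xs arbitrary: x) auto

lemma is_path_imp_relpowp:
  assumes "is_path V F u p v"
  shows "(adj F ^^ (length p - 1)) u v"
  using assms
proof (induction p arbitrary: u)
  case (Cons x p)
  show ?case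
  proof (cases "p = []")
    case False
    then have "is_path V F (hd p) p v" "adj F u (hd p)"
      using Cons.prems by (auto simp: is_path_def successively_Cons)
    then have "(adj F ^^ Suc (length p - 1)) u v" by (intro relpowp_Suc_I2[OF _ Cons.IH])
    then show ?thesis using False by (simp del: relpowp.simps)
  qed (use Cons.prems in \<open>auto simp: is_path_def\<close>)
qed (simp add: is_path_def)

lemma relpowp_imp_is_path:
  assumes "(adj F ^^ n) u v" "u \<in> V" "\<Union> F \<subseteq> V"
  shows "\<exists>p. is_path V F u p v \<and> length p \<le> Suc n"
  using assms
proof (induction n arbitrary: u)
  case 0
  then show ?case by (intro exI[of _ "[u]"]) (simp add: is_path_def)
next
  case (Suc n)
  from Suc.prems(1) obtain w where w: "adj F u w" "(adj F ^^ n) w v" by (rule relpowp_Suc_E2)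
  then obtain p where p: "is_path V F w p v" "length p \<le> Suc n" using Suc by blast
  show ?case
  proof (cases "u \<in> set p")
    case True
    then obtain ys zs where "p = ys @ u # zs" by (meson split_list)
    then have "is_path V F u (u # zs) v \<and> length (u # zs) \<le> Suc (Suc n)"
      using p by (auto simp: is_path_def successively_append_iff)
    then show ?thesis by blast
  next
    case False
    then have "is_path V F u (u # p) v"
      using p(1) w(1) Suc.prems by (cases p) (auto simp: is_path_def)
    then show ?thesis using p(2) by (intro exI[of _ "u # p"]) simp
  qed
qed

lemma reachable_imp_is_path:
  assumes "reachable F u v" "u \<in> V" "\<Union> F \<subseteq> V"
  shows "\<exists>p. is_path V F u p v"
  using rtranclp_imp_relpowp[OF assms(1)] relpowp_imp_is_path[OF _ assms(2,3)] by blast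

lemma connected_graph_iff_reachable:
  assumes "\<Union> E \<subseteq> V"
  shows "connected_graph V E \<longleftrightarrow> V \<noteq> {} \<and> (\<forall>u\<in>V. \<forall>v\<in>V. reachable E u v)"
proof -
  have "(\<exists>p. is_path V E u p v) \<longleftrightarrow> reachable E u v" if "u \<in> V" for u v
    using reachable_imp_is_path[OF _ that assms] by (auto dest: is_path_imp_relpowp relpowp_imp_rtranclp)
  then show ?thesis by (simp add: connected_graph_def)
qed

lemma cycle_edges_subset_iff:
  assumes "p \<noteq> []"
  shows "cycle_edges p \<subseteq> F \<longleftrightarrow> successively (adj F) p \<and> adj F (last p) (hd p)"
proof -
  obtain m where m: "length p = Suc m" using assms by (cases p) auto
  have "cycle_edges p = (\<lambda>i. {p ! i, p ! (Suc i mod length p)}) ` {..<Suc m}"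
    unfolding cycle_edges_def m by auto
  also have "\<dots> = insert {p ! m, p ! 0} ((\<lambda>i. {p ! i, p ! Suc i}) ` {..<m})"
    by (simp add: m lessThan_Suc)
  finally show ?thesis
    using assms m by (auto simp: successively_conv_nth last_conv_nth hd_conv_nth)
qed

lemma successively_cycle_edges: "p \<noteq> [] \<Longrightarrow> successively (adj (cycle_edges p)) p"
  and closing_edge_in_cycle_edges: "p \<noteq> [] \<Longrightarrow> {last p, hd p} \<in> cycle_edges p"
  using cycle_edges_subset_iff[of p "cycle_edges p"] by auto

lemma is_cycle_iff_closed_path:
  "is_cycle V E p \<longleftrightarrow>
     3 \<le> length p \<and> distinct p \<and> set p \<subseteq> V \<and> successively (adj E) p \<and> adj E (last p) (hd p)"
  unfolding is_cycle_def by (cases "p = []") (auto simp: cycle_edges_subset_iff)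

lemma successively_cycle_edges_minus_closing:
  assumes "distinct p" "3 \<le> length p"
  shows "successively (adj (cycle_edges p - {{last p, hd p}})) p"
proof -
  have ne: "p \<noteq> []" using assms(2) by auto
  have "{p ! i, p ! Suc i} \<noteq> {last p, hd p}" if "Suc i < length p" for i
  proof -
    have "i \<noteq> length p - 1" "Suc i \<noteq> length p - 1 \<or> i \<noteq> 0" using that assms(2) by auto
    then show ?thesis
      using that assms ne by (auto simp: last_conv_nth hd_conv_nth doubleton_eq_iff nth_eq_iff_index_eq)
  qed
  then show ?thesis
    using successively_cycle_edges[OF ne] by (simp add: successively_conv_nth)
qed

lemma cactus_cycle_edges_eq:
  assumes "cactus V E" "is_cycle V E p" "is_cycle V E q" "e \<in> cycle_edges p" "e \<in> cycle_edges q"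
  shows "cycle_edges p = cycle_edges q"
proof -
  have "e \<in> E" using assms by (auto simp: is_cycle_def)
  with assms show ?thesis unfolding cactus_def by blast
qed

definition cyclic_nth :: "'a list \<Rightarrow> int \<Rightarrow> 'a" where
  "cyclic_nth p i = p ! nat (i mod int (length p))"

lemma cyclic_nth_int: "i < length p \<Longrightarrow> cyclic_nth p (int i) = p ! i"
  by (simp add: cyclic_nth_def)

lemma cyclic_nth_cong:
  "i mod int (length p) = j mod int (length p) \<Longrightarrow> cyclic_nth p i = cyclic_nth p j"
  by (simp add: cyclic_nth_def)

lemma
  assumes "p \<noteq> []"
  shows image_cyclic_nth: "cyclic_nth p ` {0..<int (length p)} = set p"
    and range_cyclic_nth: "range (cyclic_nth p) = set p"
proof -
  have "cyclic_nth p i \<in> set p" for i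
    using assms unfolding cyclic_nth_def by (intro nth_mem) (simp add: nat_less_iff)
  moreover have "x \<in> cyclic_nth p ` {0..<int (length p)}" if x: "x \<in> set p" for x
  proof -
    obtain i where "i < length p" "x = p ! i" using x by (metis in_set_conv_nth)
    then show ?thesis by (intro image_eqI[of _ _ "int i"]) (auto simp: cyclic_nth_int)
  qed
  ultimately show "cyclic_nth p ` {0..<int (length p)} = set p" "range (cyclic_nth p) = set p"
    by blast+
qed

lemma cyclic_nth_eq_iff:
  assumes "distinct p" "p \<noteq> []"
  shows "cyclic_nth p i = cyclic_nth p j \<longleftrightarrow> i mod int (length p) = j mod int (length p)"
proof -
  have "nat (k mod int (length p)) < length p" for k using assms(2) by (simp add: nat_less_iff)
  then show ?thesis
    unfolding cyclic_nth_def by (simp add: nth_eq_iff_index_eq[OF assms(1)] eq_nat_nat_iff assms(2))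
qed

lemma cycle_edges_eq_cyclic_nth:
  assumes "p \<noteq> []"
  shows "cycle_edges p = range (\<lambda>i. {cyclic_nth p i, cyclic_nth p (i + 1)})"
proof -
  let ?n = "int (length p)"
  let ?e = "\<lambda>i. {cyclic_nth p i, cyclic_nth p (i + 1)}"
  have nth: "{p ! i, p ! (Suc i mod length p)} = ?e (int i)" if "i < length p" for i
    using that by (simp add: cyclic_nth_def nat_mod_as_int add.commute)
  have "cycle_edges p = (?e \<circ> int) ` {..<length p}"
    unfolding cycle_edges_def using nth by (auto simp: image_iff)
  moreover have "?e i \<in> (?e \<circ> int) ` {..<length p}" for i
  proof
    show "nat (i mod ?n) \<in> {..<length p}" using assms by (simp add: nat_less_iff)
    show "?e i = (?e \<circ> int) (nat (i mod ?n))"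
      using assms by (auto simp: mod_simps intro!: arg_cong2[where f=insert] cyclic_nth_cong)
  qed
  ultimately show ?thesis by auto
qed

lemma Union_cycle_edges: "\<Union> (cycle_edges p) = set p"
proof (cases "p = []")
  case False
  have "\<Union> (cycle_edges p) = range (cyclic_nth p)"
    unfolding cycle_edges_eq_cyclic_nth[OF False] by auto
  then show ?thesis by (simp add: range_cyclic_nth[OF False])
qed (simp add: cycle_edges_def)

lemma hd_upto: "i \<le> j \<Longrightarrow> hd [i..j] = i"
  by (simp add: upto_rec1)

lemma last_upto: "i \<le> j \<Longrightarrow> last [i..j] = j"
  by (simp add: upto_rec2)

lemma successively_upto: "successively (\<lambda>x y. y = x + 1) [i..j]"
  by (auto simp: successively_conv_nth)

lemma successively_cyclic_nth_upto:
  assumes "p \<noteq> []"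
  shows "successively (adj (cycle_edges p)) (map (cyclic_nth p) [i..j])"
  unfolding successively_map
  by (rule successively_mono[OF successively_upto])
    (auto simp: cycle_edges_eq_cyclic_nth[OF assms])

lemma distinct_cyclic_nth_upto:
  assumes "distinct p" "p \<noteq> []" "j < i + int (length p)"
  shows "distinct (map (cyclic_nth p) [i..j])"
proof -
  have "x = y" if "x \<in> {i..j}" "y \<in> {i..j}" "x mod int (length p) = y mod int (length p)" for x y
  proof -
    have "int (length p) dvd x - y" using that by (simp add: mod_eq_dvd_iff)
    moreover have "\<bar>x - y\<bar> < int (length p)" using that assms(3) by auto
    ultimately show ?thesis using dvd_imp_le_int[of "x - y" "int (length p)"] by force
  qed
  then show ?thesis
    using assms(1,2) by (auto simp: distinct_map inj_on_def cyclic_nth_eq_iff)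
qed

section \<open>Distances in connected graphs\<close>

locale connected_simple_graph =
  fixes V :: "'a set" and E :: "'a set set"
  assumes graph: "finite_simple_graph V E" and conn: "connected_graph V E"
begin

abbreviation d :: "'a \<Rightarrow> 'a \<Rightarrow> nat" where "d \<equiv> graph_dist V E"

lemma finite_V: "finite V"
  using graph by (simp add: finite_simple_graph_def)

lemma Union_E_subset: "\<Union> E \<subseteq> V"
  using graph by (auto simp: finite_simple_graph_def)

lemma finite_E: "finite E"
  using finite_V Union_E_subset by (meson finite_UnionD finite_subset)

lemma adjD:
  assumes "adj E x y"
  shows "x \<in> V" "y \<in> V" "x \<noteq> y"
  using assms graph by (auto simp: finite_simple_graph_def)

lemma reachable_E: "u \<in> V \<Longrightarrow> v \<in> V \<Longrightarrow> reachable E u v"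
  using conn connected_graph_iff_reachable[OF Union_E_subset] by blast

lemma relpowp_dist:
  assumes "u \<in> V" "v \<in> V"
  shows "(adj E ^^ d u v) u v"
proof -
  have "\<exists>n p. is_path V E u p v \<and> n = length p - 1"
    using conn assms by (auto simp: connected_graph_def)
  then have "\<exists>p. is_path V E u p v \<and> d u v = length p - 1"
    unfolding graph_dist_def by (rule LeastI_ex)
  then show ?thesis using is_path_imp_relpowp by metis
qed

lemma dist_le_if_relpowp:
  assumes "(adj E ^^ n) u v" "u \<in> V"
  shows "d u v \<le> n"
proof -
  obtain p where p: "is_path V E u p v" "length p \<le> Suc n"
    using relpowp_imp_is_path[OF assms Union_E_subset] by blast
  have "d u v \<le> length p - 1"
    unfolding graph_dist_def using p(1) by (intro Least_le) blast
  then show ?thesis using p(2) by simp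
qed

lemma dist_refl [simp]: "u \<in> V \<Longrightarrow> d u u = 0"
  using dist_le_if_relpowp[of 0 u u] by simp

lemma dist_eq_0_iff: "u \<in> V \<Longrightarrow> v \<in> V \<Longrightarrow> d u v = 0 \<longleftrightarrow> u = v"
  using relpowp_dist[of u v] by fastforce

lemma dist_triangle:
  assumes "u \<in> V" "v \<in> V" "w \<in> V"
  shows "d u w \<le> d u v + d v w"
  using relpowp_trans[OF relpowp_dist[of u v] relpowp_dist[of v w]] assms
  by (intro dist_le_if_relpowp)

lemma dist_commute:
  assumes "u \<in> V" "v \<in> V"
  shows "d u v = d v u"
  using dist_le_if_relpowp[OF relpowp_adj_sym[OF relpowp_dist]] assms by (meson antisym)

lemma dist_adj_le_1: "adj E u v \<Longrightarrow> d u v \<le> 1"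
  using adjD(1) by (intro dist_le_if_relpowp) auto

lemma dist_le_Suc_dist_if_adj:
  assumes "adj E u w" "v \<in> V"
  shows "d u v \<le> Suc (d w v)"
  using dist_triangle[of u w v] dist_adj_le_1[of u w] adjD[of u w] assms by simp

lemma adj_closer:
  assumes "u \<in> V" "v \<in> V" "u \<noteq> v"
  obtains w where "adj E u w" "d u v = Suc (d w v)"
proof -
  obtain n where n: "d u v = Suc n" using dist_eq_0_iff[of u v] assms by (cases "d u v") auto
  then have "(adj E ^^ Suc n) u v" using relpowp_dist[of u v] assms by metis
  then obtain w where w: "adj E u w" "(adj E ^^ n) w v" by (rule relpowp_Suc_E2)
  have "d w v \<le> n" using w adjD by (intro dist_le_if_relpowp)
  then show ?thesis using that w n dist_le_Suc_dist_if_adj[OF w(1) assms(2)] by simp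
qed

lemma diff_le_dist_if_edgewise:
  fixes f :: "'a \<Rightarrow> int"
  assumes step: "\<And>x y. adj E x y \<Longrightarrow> f x \<le> f y + 1" and uv: "u \<in> V" "v \<in> V"
  shows "f u - f v \<le> int (d u v)"
proof -
  have "f x - f v \<le> int n" if "(adj E ^^ n) x v" for n x
    using that
  proof (induction n arbitrary: x)
    case (Suc n)
    from Suc.prems obtain w where w: "adj E x w" "(adj E ^^ n) w v" by (rule relpowp_Suc_E2)
    then show ?case using Suc.IH[OF w(2)] step[OF w(1)] by simp
  qed simp
  then show ?thesis using relpowp_dist[OF uv] by blast
qed

definition dist_diff :: "'a \<Rightarrow> 'a \<Rightarrow> 'a \<Rightarrow> int" where
  "dist_diff u v x = int (d x u) - int (d x v)"

lemma dist_diff_swap: "dist_diff u v x = - dist_diff v u x"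
  by (simp add: dist_diff_def)

lemma dist_diff_eq_0_iff: "dist_diff u v x = 0 \<longleftrightarrow> d x u = d x v"
  by (simp add: dist_diff_def)

lemma reachable_avoiding_vertex:
  assumes "y \<in> V" "x \<in> V" "v \<in> V" "d y v < d y x + d x v"
  shows "reachable {e \<in> E. x \<notin> e} y v"
  using assms(1,4)
proof (induction "d y v" arbitrary: y)
  case 0
  then show ?case using dist_eq_0_iff assms(3) by simp
next
  case (Suc n)
  then have "y \<noteq> v" using assms(3) by auto
  then obtain z where z: "adj E y z" "d y v = Suc (d z v)"
    using adj_closer Suc.prems(1) assms(3) by blast
  have "d y x \<le> Suc (d z x)" using dist_le_Suc_dist_if_adj z(1) assms(2) by blast
  then have less: "d z v < d z x + d x v" using Suc.prems(2) z(2) by simp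
  then have "adj {e \<in> E. x \<notin> e} y z"
    using z(1) Suc.prems(2) assms(2) by auto
  moreover have "reachable {e \<in> E. x \<notin> e} z v"
    using Suc.hyps z less adjD(2)[OF z(1)] by simp
  ultimately show ?case by (rule converse_rtranclp_into_rtranclp)
qed

lemma cycle_through_neighbours:
  assumes y: "adj E x y" and z: "adj E x z" and "y \<noteq> z"
    and reach: "reachable {e \<in> E. x \<notin> e} y z"
  shows "\<exists>p. is_cycle V E p \<and> x \<in> set p \<and> y \<in> set p"
proof -
  let ?F = "{e \<in> E. x \<notin> e}"
  have "y \<in> V - {x}" "\<Union> ?F \<subseteq> V - {x}"
    using adjD(2,3)[OF y] Union_E_subset by auto
  from reachable_imp_is_path[OF reach this] obtain q where q: "is_path (V - {x}) ?F y q z" ..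
  then obtain q' where "q = y # q'" by (cases q) (auto simp: is_path_def)
  with q \<open>y \<noteq> z\<close> have q': "q = y # q'" "q' \<noteq> []" by (auto simp: is_path_def)
  have "successively (adj ?F) q" using q by (simp add: is_path_def)
  then have "successively (adj E) q" by (rule successively_mono) blast
  then have "is_cycle V E (x # q)"
    using q q' y z adjD(1)[OF y]
    by (cases q') (auto simp: is_cycle_iff_closed_path is_path_def insert_commute)
  then show ?thesis using q' by (intro exI[of _ "x # q"]) simp
qed

end

section \<open>The retraction of a cactus onto one of its cycles\<close>

locale cactus_cycle = connected_simple_graph +
  fixes p :: "'a list"
  assumes cactus: "cactus V E" and cycle: "is_cycle V E p"
begin

abbreviation len :: int where "len \<equiv> int (length p)"

abbreviation vert :: "int \<Rightarrow> 'a" where "vert \<equiv> cyclic_nth p"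

abbreviation off_cycle :: "'a set set" where "off_cycle \<equiv> E - cycle_edges p"

lemma len_ge_3: "3 \<le> len" and distinct_p: "distinct p" and p_V: "set p \<subseteq> V"
  and cycle_edges_E: "cycle_edges p \<subseteq> E" and p_not_Nil [simp]: "p \<noteq> []"
  using cycle by (auto simp: is_cycle_def)

lemmas vert_eq_iff = cyclic_nth_eq_iff[OF distinct_p p_not_Nil]

lemma vert_in_p [simp]: "vert i \<in> set p"
  using range_cyclic_nth[OF p_not_Nil] by blast

lemma vert_V [simp]: "vert i \<in> V"
  using p_V by auto

lemma vertE:
  assumes "x \<in> set p"
  obtains i where "x = vert i"
  using assms range_cyclic_nth[OF p_not_Nil] by blast

lemma vert_edge: "{vert i, vert (i + 1)} \<in> cycle_edges p"
  by (simp add: cycle_edges_eq_cyclic_nth[OF p_not_Nil])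

lemma closing_edge_of_detour:
  assumes "i \<le> j" "successively (adj F) (vert j # ys @ [vert i])"
  shows "adj F (last (map vert [i..j] @ ys)) (hd (map vert [i..j] @ ys))"
proof (cases ys rule: rev_cases)
  case Nil
  then show ?thesis using assms by (simp add: last_map hd_map last_upto hd_upto)
next
  case (snoc zs z)
  then show ?thesis using assms by (simp add: hd_map hd_upto successively_append_iff successively_Cons)
qed

lemma is_cycle_arc_with_detour:
  assumes ij: "i < j" "j < i + len"
    and ys: "successively (adj off_cycle) (vert j # ys @ [vert i])" "distinct ys" "set ys \<inter> set p = {}"
  shows "is_cycle V E (map vert [i..j] @ ys)" (is "is_cycle V E ?q")
  unfolding is_cycle_iff_closed_path
proof (intro conjI)
  have "j \<noteq> i + 1 \<or> ys \<noteq> []"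
    using vert_edge[of i] ys(1) by (auto simp: insert_commute)
  then show "3 \<le> length ?q" using ij by (cases ys) auto
  show "distinct ?q"
    using ys(2,3) distinct_cyclic_nth_upto[OF distinct_p p_not_Nil ij(2)] by auto
  have "set ys \<subseteq> \<Union> off_cycle" using successively_adj_subset_Union[OF ys(1)] by simp
  then show "set ?q \<subseteq> V" using Union_E_subset by auto
  have "successively (adj E) (map vert [i..j])"
    using successively_cyclic_nth_upto[OF p_not_Nil]
    by (rule successively_mono) (use cycle_edges_E in auto)
  moreover have "last (map vert [i..j]) = vert j" using ij by (simp add: last_map last_upto)
  moreover have "successively (adj off_cycle) (vert j # ys)"
    using ys(1) successively_append_iff[of _ "vert j # ys" "[vert i]"] by simp
  then have "successively (adj E) (vert j # ys)" by (rule successively_mono) auto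
  ultimately show "successively (adj E) ?q"
    using ij by (cases ys) (auto simp: successively_append_iff)
  show "adj E (last ?q) (hd ?q)"
    using closing_edge_of_detour[OF _ ys(1)] ij(1) by simp
qed

text \<open>The detour and the arc form a cycle which shares the edges of the arc with the given one.\<close>

lemma no_detour_off_cycle:
  assumes ij: "i < j" "j < i + len"
    and ys: "successively (adj off_cycle) (vert j # ys @ [vert i])" "distinct ys" "set ys \<inter> set p = {}"
  shows False
proof -
  let ?q = "map vert [i..j] @ ys"
  have q: "?q = vert i # vert (i + 1) # map vert [i + 2..j] @ ys"
    using ij(1) by (simp add: upto_rec1 add.commute[of 2])
  then have "{vert i, vert (i + 1)} \<in> cycle_edges ?q"
    using successively_cycle_edges[of ?q] by simp
  then have "cycle_edges ?q = cycle_edges p"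
    using cactus_cycle_edges_eq[OF cactus is_cycle_arc_with_detour[OF assms] cycle] vert_edge by blast
  moreover have "{last ?q, hd ?q} \<in> cycle_edges ?q"
    by (rule closing_edge_in_cycle_edges) (simp add: q)
  moreover have "{last ?q, hd ?q} \<notin> cycle_edges p"
    using closing_edge_of_detour[OF _ ys(1)] ij(1) by simp
  ultimately show False by simp
qed

lemma reachable_off_cycle_eq:
  assumes "x \<in> set p" "y \<in> set p" "reachable off_cycle x y"
  shows "x = y"
proof (rule ccontr)
  assume "x \<noteq> y"
  have "\<Union> off_cycle \<subseteq> V" using Union_E_subset by blast
  from reachable_imp_is_path[OF assms(3) _ this] obtain q where q: "is_path V off_cycle x q y"
    using assms(1) p_V by blast
  then obtain q' where q': "q = x # q'" by (cases q) (auto simp: is_path_def)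
  then have "y \<in> set q'" using q \<open>x \<noteq> y\<close> by (auto simp: is_path_def)
  then have "\<exists>z\<in>set q'. z \<in> set p" using assms(2) by blast
  from split_list_first_prop[OF this] obtain ys z zs where
    z: "q' = ys @ z # zs" "z \<in> set p" "\<forall>y\<in>set ys. y \<notin> set p" by blast
  have path: "successively (adj off_cycle) (x # ys @ [z])" "distinct (x # ys @ [z])"
    using q unfolding q' z(1) is_path_def
    by (auto simp: successively_append_iff successively_Cons hd_append split: if_splits)
  obtain i k where i: "z = vert i" and k: "x = vert k" using assms(1) z(2) by (metis vertE)
  define j where "j = i + (k - i) mod len"
  have "(k - i) mod len < len" "0 < (k - i) mod len"
    using len_ge_3 path(2) i k mod_diff_pos[of len k i] by (auto simp: vert_eq_iff)
  then have "i < j" "j < i + len" by (auto simp: j_def)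
  moreover have "x = vert j" by (simp add: k j_def vert_eq_iff mod_simps)
  ultimately show False
    using no_detour_off_cycle[of i j ys] path z(3) i by auto
qed

lemma cycle_reachable_off_cycle:
  assumes "z \<in> V"
  shows "\<exists>g\<in>set p. reachable off_cycle z g"
  using reachable_E[OF assms vert_V[of 0]]
proof (induction rule: converse_rtranclp_induct)
  case base
  then show ?case using vert_in_p by blast
next
  case (step y z)
  show ?case
  proof (cases "y \<in> set p")
    case False
    then have "adj off_cycle y z" using step.hyps(1) Union_cycle_edges[of p] by auto
    then show ?thesis using step.IH by (meson converse_rtranclp_into_rtranclp)
  qed blast
qed

definition gate :: "'a \<Rightarrow> 'a" where
  "gate z = (SOME g. g \<in> set p \<and> reachable off_cycle z g)"

lemma
  assumes "z \<in> V"
  shows gate_in_p: "gate z \<in> set p" and reachable_gate: "reachable off_cycle z (gate z)"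
proof -
  have "\<exists>g. g \<in> set p \<and> reachable off_cycle z g"
    using cycle_reachable_off_cycle[OF assms] by blast
  then have "gate z \<in> set p \<and> reachable off_cycle z (gate z)" unfolding gate_def by (rule someI_ex)
  then show "gate z \<in> set p" "reachable off_cycle z (gate z)" by auto
qed

lemma gate_V: "z \<in> V \<Longrightarrow> gate z \<in> V"
  using gate_in_p p_V by blast

lemma gate_eq_if_reachable:
  assumes "x \<in> V" "y \<in> V" "reachable off_cycle x y"
  shows "gate x = gate y"
proof (rule reachable_off_cycle_eq)
  have "reachable off_cycle (gate x) x" using assms(1) by (rule reachable_sym[OF reachable_gate])
  also note assms(3)
  also (rtranclp_trans) have "reachable off_cycle y (gate y)" using assms(2) by (rule reachable_gate)
  finally (rtranclp_trans) show "reachable off_cycle (gate x) (gate y)" .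
qed (use assms gate_in_p in auto)

lemma gate_id:
  assumes "x \<in> set p"
  shows "gate x = x"
proof -
  have "x \<in> V" using assms p_V by blast
  then show ?thesis
    using reachable_off_cycle_eq[OF assms gate_in_p reachable_gate] by simp
qed

lemma gate_vert [simp]: "gate (vert i) = vert i"
  by (simp add: gate_id)

lemma adj_cases:
  assumes "adj E x y"
  obtains (same_gate) "gate x = gate y"
    | (forwards) i where "x = vert i" "y = vert (i + 1)"
    | (backwards) i where "x = vert (i + 1)" "y = vert i"
proof (cases "{x, y} \<in> cycle_edges p")
  case True
  then obtain i where "{x, y} = {vert i, vert (i + 1)}"
    unfolding cycle_edges_eq_cyclic_nth[OF p_not_Nil] by blast
  then show ?thesis using forwards backwards by (auto simp: doubleton_eq_iff)
next
  case False
  then have "adj off_cycle x y" using assms by simp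
  then show ?thesis
    using same_gate gate_eq_if_reachable[OF adjD(1,2)[OF assms] r_into_rtranclp] by simp
qed

lemma adj_gate_neq:
  assumes "adj E x y" "gate x \<noteq> gate y"
  shows "x \<in> set p"
  using assms by (cases rule: adj_cases) auto

lemma dist_through_gate:
  assumes x: "x \<in> V" and y: "y \<in> V" and ne: "gate x \<noteq> gate y"
  shows "d x y = d x (gate x) + d (gate x) y"
proof (rule antisym)
  let ?g = "gate x"
  have g: "?g \<in> V" using gate_V x by blast
  show "d x y \<le> d x ?g + d ?g y" using dist_triangle x y g by blast
  define f where "f z = int (if gate z = ?g then d z ?g + d ?g y else d z y)" for z
  have "f z \<le> f w + 1" if zw: "adj E z w" for z w
  proof -
    have "d z v \<le> Suc (d w v)" if "v \<in> V" for v using dist_le_Suc_dist_if_adj[OF zw that] .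
    note step = this[OF g] this[OF y]
    show ?thesis
    proof (cases "gate z = gate w")
      case True
      then show ?thesis using step by (auto simp: f_def)
    next
      case False
      have "gate z = z" using adj_gate_neq[OF zw False] gate_id by blast
      moreover have "adj E w z" using zw by (simp add: insert_commute)
      from adj_gate_neq[OF this] False have "gate w = w" using gate_id by metis
      ultimately show ?thesis
        using False step g by (auto simp: f_def)
    qed
  qed
  from diff_le_dist_if_edgewise[of f, OF this x y] show "d x ?g + d ?g y \<le> d x y"
    using ne y by (simp add: f_def)
qed

lemma dist_from_cycle:
  assumes "c \<in> set p" "x \<in> V"
  shows "d c x = d c (gate x) + d (gate x) x"
proof (cases "c = gate x")
  case True
  then show ?thesis using assms gate_V by simp
next
  case False
  have V: "c \<in> V" "gate x \<in> V" using assms p_V gate_V by auto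
  have "d x c = d x (gate x) + d (gate x) c"
    using False assms V by (intro dist_through_gate) (simp_all add: gate_id)
  then show ?thesis using V assms(2) by (simp add: dist_commute)
qed

subsection \<open>Distances on the cycle\<close>

definition position :: "'a \<Rightarrow> int" where
  "position x = (SOME i. x = vert i)"

lemma vert_position: "x \<in> set p \<Longrightarrow> vert (position x) = x"
  unfolding position_def by (erule vertE) (metis (mono_tags) someI)

lemma cyclic_dist_position: "cyclic_dist len (position (vert i)) j = cyclic_dist len i j"
proof (rule cyclic_dist_cong)
  have "position (vert i) mod len = i mod len"
    using vert_position[of "vert i"] by (simp add: vert_eq_iff)
  then show "(position (vert i) - j) mod len = (i - j) mod len" by (rule mod_diff_cong) simp
qed

text \<open>The retraction maps edges to edges or vertices, so it does not increase distances.\<close>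

lemma cyclic_dist_le_dist: "cyclic_dist len i j \<le> int (d (vert i) (vert j))"
proof -
  define f where "f z = cyclic_dist len (position (gate z)) j" for z
  have f_vert: "f (vert k) = cyclic_dist len k j" for k by (simp add: f_def cyclic_dist_position)
  have "f x \<le> f y + 1" if "adj E x y" for x y
    using that
  proof (cases rule: adj_cases)
    case same_gate
    then show ?thesis by (simp add: f_def)
  next
    case (forwards k)
    then show ?thesis using cyclic_dist_succ[of len k j] len_ge_3 by (simp add: f_vert)
  next
    case (backwards k)
    then show ?thesis using cyclic_dist_succ[of len k j] len_ge_3 by (simp add: f_vert)
  qed
  from diff_le_dist_if_edgewise[of f, OF this vert_V vert_V] show ?thesis
    using f_vert by (metis cyclic_dist_self diff_0_right)
qed

lemma dist_vert_le_mod: "int (d (vert i) (vert j)) \<le> (j - i) mod len"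
proof -
  have "d (vert i) (vert (i + int k)) \<le> k" for k
  proof (induction k)
    case (Suc k)
    have "adj E (vert (i + int k)) (vert (i + int (Suc k)))"
      using vert_edge[of "i + int k"] cycle_edges_E by (auto simp: add_ac)
    then show ?case
      using Suc dist_adj_le_1 dist_triangle[OF vert_V[of i] vert_V[of "i + int k"] vert_V[of "i + int (Suc k)"]]
      by fastforce
  qed simp
  moreover have "vert (i + (j - i) mod len) = vert j" by (simp add: vert_eq_iff mod_simps)
  moreover have "0 \<le> (j - i) mod len" using len_ge_3 by simp
  ultimately show ?thesis by (metis int_nat_eq of_nat_mono)
qed

lemma dist_vert: "int (d (vert i) (vert j)) = cyclic_dist len i j"
proof (rule antisym)
  show "int (d (vert i) (vert j)) \<le> cyclic_dist len i j"
    using dist_vert_le_mod[of i j] dist_vert_le_mod[of j i] dist_commute[of "vert i" "vert j"]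
    by (simp add: cyclic_dist_def)
qed (rule cyclic_dist_le_dist)

subsection \<open>Vertices of the cycle that determine the gate\<close>

lemma doubly_resolving_insert_third_vertex:
  assumes "x \<in> set p" "y \<in> set p" "x \<noteq> y"
  shows "\<exists>t\<in>set p. doubly_resolving (\<lambda>z a. int (d z a)) (set p) {x, y, t}"
proof -
  obtain i j where ij: "x = vert i" "y = vert j" using assms(1,2) by (metis vertE)
  then have "i mod len \<noteq> j mod len" using assms(3) by (simp add: vert_eq_iff)
  from doubly_resolving_insert_third[OF len_ge_3 this] obtain k where
    "doubly_resolving (cyclic_dist len) {0..<len} {i, j, k}" ..
  from doubly_resolving_image[OF this, of "\<lambda>z a. int (d z a)" vert] show ?thesis
    unfolding dist_vert image_cyclic_nth[OF p_not_Nil] using ij by auto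
qed

lemma dist_diff_nonpos_at_gate:
  assumes "u \<in> V" "v \<in> V" "S \<subseteq> V" "\<And>s. s \<in> S \<Longrightarrow> dist_diff u v s = 0"
    and "z \<in> gate ` S" "z \<noteq> gate u"
  shows "dist_diff u v z \<le> 0"
proof -
  obtain s where s: "s \<in> S" "s \<in> V" "z = gate s" using assms by blast
  then have "d s u = d s z + d z u" using dist_through_gate[of s u] assms by simp
  moreover have "d s v \<le> d s z + d z v" using dist_triangle[of s z v] gate_V s assms by simp
  ultimately show ?thesis using assms(4)[OF s(1)] by (simp add: dist_diff_def)
qed

lemma dist_diff_minimal_at_gate:
  assumes "u \<in> V" "v \<in> V" "z \<in> set p"
  shows "dist_diff u v (gate u) \<le> dist_diff u v z"
  using dist_triangle[of z "gate u" v] dist_from_cycle[of z u] gate_V p_V assms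
  by (auto simp: dist_diff_def)

lemma dist_diff_on_cycle:
  assumes "u \<in> V" "v \<in> V" "z \<in> set p"
  shows "dist_diff u v z = dist_diff (gate u) (gate v) z + int (d (gate u) u) - int (d (gate v) v)"
  using dist_from_cycle[of z u] dist_from_cycle[of z v] assms by (simp add: dist_diff_def)

text \<open>At a gate of \<open>S\<close> the difference is nonpositive unless this is the gate of \<open>u\<close>, where the
  difference is minimal on the cycle, and nonnegative unless this is the gate of \<open>v\<close>, where it
  is maximal. As \<open>X\<close> has two elements, the difference vanishes on it.\<close>

lemma dist_diff_eq_0_on_gates:
  assumes uv: "u \<in> V" "v \<in> V" and S: "S \<subseteq> V" "\<And>s. s \<in> S \<Longrightarrow> dist_diff u v s = 0"
    and X: "X \<subseteq> gate ` S" "x \<in> X" "y \<in> X" "x \<noteq> y" and z: "z \<in> X"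
  shows "dist_diff u v z = 0"
proof (rule antisym)
  have S': "dist_diff v u s = 0" if "s \<in> S" for s using S(2)[OF that] by (simp add: dist_diff_swap[of v])
  have nonpos: "dist_diff u v z \<le> 0" if "z \<in> X" "z \<noteq> gate u" for z
    using dist_diff_nonpos_at_gate[OF uv S] that X(1) by blast
  have nonneg: "0 \<le> dist_diff u v z" if "z \<in> X" "z \<noteq> gate v" for z
    using dist_diff_nonpos_at_gate[OF uv(2,1) S(1) S', of z] that X(1) by (auto simp: dist_diff_swap[of v])
  obtain w where w: "w \<in> X" "w \<noteq> z" using X(2-4) by metis
  then have "w \<in> set p" using X(1) S(1) gate_in_p by blast
  then have "dist_diff u v (gate u) \<le> dist_diff u v w" "dist_diff u v w \<le> dist_diff u v (gate v)"
    using dist_diff_minimal_at_gate[OF uv] dist_diff_minimal_at_gate[OF uv(2,1), of w]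
    by (auto simp: dist_diff_swap[of v])
  then show "dist_diff u v z \<le> 0" "0 \<le> dist_diff u v z"
    using nonpos[OF z] nonpos[OF w(1)] nonneg[OF z] nonneg[OF w(1)] w(2) by force+
qed

lemma gate_eq_if_unresolved:
  assumes uv: "u \<in> V" "v \<in> V" and S: "S \<subseteq> V" "\<And>s. s \<in> S \<Longrightarrow> dist_diff u v s = 0"
    and X: "X \<subseteq> gate ` S" "x \<in> X" "y \<in> X" "x \<noteq> y"
    and dres: "doubly_resolving (\<lambda>z a. int (d z a)) (set p) X"
  shows "gate u = gate v"
proof -
  have "dist_diff (gate u) (gate v) z = int (d (gate v) v) - int (d (gate u) u)" if "z \<in> X" for z
  proof -
    have "z \<in> set p" using that X(1) S(1) gate_in_p by blast
    then show ?thesis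
      using dist_diff_eq_0_on_gates[OF uv S X that] dist_diff_on_cycle[OF uv] by force
  qed
  then show ?thesis
    using dres gate_in_p uv unfolding doubly_resolving_def dist_diff_def by blast
qed

end

section \<open>Forts\<close>

definition fort :: "'a set \<Rightarrow> 'a set set \<Rightarrow> 'a set \<Rightarrow> bool" where
  "fort V E F \<longleftrightarrow> F \<subseteq> V \<and> F \<noteq> {} \<and> (\<forall>x\<in>V - F. \<forall>w. {y \<in> F. adj E x y} \<noteq> {w})"

lemma zero_forcing_set_meets_fort:
  assumes S: "zero_forcing_set V E S" and F: "fort V E F"
  shows "S \<inter> F \<noteq> {}"
proof
  assume disj: "S \<inter> F = {}"
  have SV: "S \<subseteq> V" and "(force_step V E)\<^sup>*\<^sup>* S V"
    using S by (auto simp: zero_forcing_set_def)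
  have "B \<subseteq> V \<and> B \<inter> F = {}" if "(force_step V E)\<^sup>*\<^sup>* S B" for B
    using that
  proof (induction rule: rtranclp_induct)
    case base
    show ?case using SV disj by simp
  next
    case (step B B')
    then have B: "B \<subseteq> V" "B \<inter> F = {}" by auto
    obtain u v where u: "u \<in> B" and v: "{w \<in> V. adj E u w \<and> w \<notin> B} = {v}" and B': "B' = insert v B"
      using step.hyps(2) unfolding force_step_def by blast
    have "v \<notin> F"
    proof
      assume "v \<in> F"
      have "F \<subseteq> V" using F by (simp add: fort_def)
      then have "y = v" if "y \<in> F" "adj E u y" for y using v B(2) that by blast
      moreover have "adj E u v" using v by blast
      ultimately have "{y \<in> F. adj E u y} = {v}" using \<open>v \<in> F\<close> by blast
      moreover have "u \<in> V - F" using u B by blast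
      ultimately show False using F unfolding fort_def by blast
    qed
    then show ?case using B v B' by auto
  qed
  from this[OF \<open>(force_step V E)\<^sup>*\<^sup>* S V\<close>] show False using F by (auto simp: fort_def)
qed

context connected_simple_graph
begin

text \<open>Geodesics to \<open>v\<close> from \<open>w\<close> and from a neighbour of \<open>x\<close> closer to \<open>u\<close> avoid \<open>x\<close>.\<close>

lemma cycle_through_force:
  assumes uv: "u \<in> V" "v \<in> V" and xw: "adj E x w" "dist_diff u v x = 0" "0 < dist_diff u v w"
    and only: "\<And>y. adj E x y \<Longrightarrow> dist_diff u v y \<noteq> 0 \<Longrightarrow> y = w"
  shows "\<exists>p. is_cycle V E p \<and> x \<in> set p \<and> w \<in> set p"
proof -
  have V: "x \<in> V" "w \<in> V" using xw(1) adjD by blast+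
  have xuv: "d x u = d x v" and wuv: "d w v < d w u" using xw(2,3) by (auto simp: dist_diff_def)
  have "x \<noteq> u" using xuv wuv uv V dist_eq_0_iff[of x v] by auto
  then obtain x' where x': "adj E x x'" "d x u = Suc (d x' u)" using adj_closer[OF V(1) uv(1)] by blast
  have x'V: "x' \<in> V" using x'(1) adjD by blast
  have "x' \<noteq> w" using x'(2) xuv wuv dist_le_Suc_dist_if_adj[OF xw(1) uv(2)] by auto
  then have "d x' u = d x' v" using only[OF x'(1)] by (auto simp: dist_diff_eq_0_iff)
  then have "d x' v < d x' x + d x v" using x'(2) xuv by simp
  then have x'v: "reachable {e \<in> E. x \<notin> e} x' v"
    using reachable_avoiding_vertex x'V V(1) uv(2) by blast
  have "d w v < d w x + d x v" using dist_triangle[OF V(2,1) uv(1)] xuv wuv by simp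
  then have "reachable {e \<in> E. x \<notin> e} w v"
    using reachable_avoiding_vertex V uv(2) by blast
  then have "reachable {e \<in> E. x \<notin> e} w x'"
    by (rule rtranclp_trans[OF _ reachable_sym[OF x'v]])
  then show ?thesis using cycle_through_neighbours[OF xw(1) x'(1)] \<open>x' \<noteq> w\<close> by blast
qed

lemma fort_dist_diff_neq_0:
  assumes uv: "u \<in> V" "v \<in> V" "u \<noteq> v"
    and const: "\<And>p x w. is_cycle V E p \<Longrightarrow> x \<in> set p \<Longrightarrow> w \<in> set p \<Longrightarrow>
      dist_diff u v x = dist_diff u v w"
  shows "fort V E {x \<in> V. dist_diff u v x \<noteq> 0}" (is "fort V E ?F")
  unfolding fort_def
proof (intro conjI ballI allI notI)
  show "?F \<subseteq> V" by blast
  have "u \<in> ?F" using uv dist_eq_0_iff[of u v] by (simp add: dist_diff_eq_0_iff)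
  then show False if "?F = {}" using that by blast
  fix x w assume x: "x \<in> V - ?F" and w: "{y \<in> ?F. adj E x y} = {w}"
  have xw: "adj E x w" "dist_diff u v x = 0" "dist_diff u v w \<noteq> 0" using x w by auto
  have only: "y = w" if "adj E x y" "dist_diff u v y \<noteq> 0" for y
    using w that adjD(2)[OF that(1)] by blast
  have "\<exists>p. is_cycle V E p \<and> x \<in> set p \<and> w \<in> set p"
  proof (cases "0 < dist_diff u v w")
    case True
    then show ?thesis using cycle_through_force[OF uv(1,2) xw(1,2)] only by blast
  next
    case False
    then have "0 < dist_diff v u w" "dist_diff v u x = 0"
      using xw(2,3) by (auto simp: dist_diff_swap[of v])
    then show ?thesis
      using cycle_through_force[OF uv(2,1) xw(1)] only by (auto simp: dist_diff_swap[of v])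
  qed
  then show False using const[of _ x w] xw(2,3) by force
qed

definition pins_dist_diff :: "'a set \<Rightarrow> 'a set \<Rightarrow> bool" where
  "pins_dist_diff R A \<longleftrightarrow>
     (\<forall>u\<in>V. \<forall>v\<in>V. (\<forall>s\<in>R. dist_diff u v s = 0) \<longrightarrow>
       (\<forall>x\<in>A. \<forall>w\<in>A. dist_diff u v x = dist_diff u v w))"

lemma pins_dist_diff_mono: "pins_dist_diff R A \<Longrightarrow> R \<subseteq> R' \<Longrightarrow> pins_dist_diff R' A"
  unfolding pins_dist_diff_def by blast

lemma resolving_set_if_pins_dist_diff:
  assumes S: "zero_forcing_set V E S" and R: "S \<subseteq> R" "R \<subseteq> V"
    and pins: "\<And>p. is_cycle V E p \<Longrightarrow> pins_dist_diff R (set p)"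
  shows "resolving_set V E R"
  unfolding resolving_set_def
proof (intro conjI ballI impI)
  fix u v assume uv: "u \<in> V" "v \<in> V" "u \<noteq> v"
  show "\<exists>s\<in>R. d s u \<noteq> d s v"
  proof (rule ccontr)
    assume "\<not> ?thesis"
    then have unres: "\<forall>s\<in>R. dist_diff u v s = 0" by (simp add: dist_diff_eq_0_iff)
    have "dist_diff u v x = dist_diff u v w" if "is_cycle V E p" "x \<in> set p" "w \<in> set p" for p x w
      using pins[OF that(1)] unres uv(1,2) that(2,3) unfolding pins_dist_diff_def by blast
    then have "fort V E {x \<in> V. dist_diff u v x \<noteq> 0}" by (rule fort_dist_diff_neq_0[OF uv])
    then show False using zero_forcing_set_meets_fort[OF S] unres R(1) by blast
  qed
qed (rule R(2))

end

context cactus_cycle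
begin

lemma fort_gate_neq:
  assumes g: "g \<in> set p"
  shows "fort V E {x \<in> V. gate x \<noteq> g}" (is "fort V E ?F")
  unfolding fort_def
proof (intro conjI ballI allI notI)
  obtain i where i: "g = vert i" using g by (rule vertE)
  have neq: "vert (i + k) \<noteq> vert (i + l)" if "k \<noteq> l" "\<bar>k - l\<bar> < len" for k l
    using that dvd_imp_le_int[of "k - l" len] by (auto simp: vert_eq_iff mod_eq_dvd_iff)
  show "?F \<subseteq> V" by blast
  have F: "vert (i + 1) \<in> ?F" "vert (i - 1) \<in> ?F"
    using neq[of 1 0] neq[of "- 1" 0] len_ge_3 i by auto
  then show False if "?F = {}" using that by blast
  fix x w assume x: "x \<in> V - ?F" and w: "{y \<in> ?F. adj E x y} = {w}"
  then have xw: "adj E x w" "gate x = g" "gate w \<noteq> g" by auto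
  then have "x = vert i" using adj_gate_neq[OF xw(1)] gate_id i by simp
  moreover have "adj E (vert i) (vert (i + 1))" "adj E (vert i) (vert (i - 1))"
    using vert_edge[of i] vert_edge[of "i - 1"] cycle_edges_E by (auto simp: insert_commute)
  ultimately have "vert (i + 1) = w" "vert (i - 1) = w" using F w by blast+
  then show False using neq[of 1 "- 1"] len_ge_3 by simp
qed

lemma zero_forcing_set_two_gates:
  assumes S: "zero_forcing_set V E S"
  shows "\<exists>s\<in>S. \<exists>s'\<in>S. gate s \<noteq> gate s'"
proof -
  have SV: "S \<subseteq> V" using S by (simp add: zero_forcing_set_def)
  obtain s where s: "s \<in> S" using zero_forcing_set_meets_fort[OF S fort_gate_neq[OF vert_in_p]] by blast
  then have "gate s \<in> set p" using gate_in_p SV by blast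
  from zero_forcing_set_meets_fort[OF S fort_gate_neq[OF this]]
  show ?thesis using s by blast
qed

lemma pins_dist_diff_insert_cycle_vertex:
  assumes S: "zero_forcing_set V E S"
  shows "\<exists>t\<in>V. pins_dist_diff (insert t S) (set p)"
proof -
  have SV: "S \<subseteq> V" using S by (simp add: zero_forcing_set_def)
  obtain s s' where s: "s \<in> S" "s' \<in> S" "gate s \<noteq> gate s'"
    using zero_forcing_set_two_gates[OF S] by blast
  then have "gate s \<in> set p" "gate s' \<in> set p" using SV gate_in_p by auto
  from doubly_resolving_insert_third_vertex[OF this s(3)] obtain t where
    t: "t \<in> set p" "doubly_resolving (\<lambda>z a. int (d z a)) (set p) {gate s, gate s', t}" ..
  have X: "{gate s, gate s', t} \<subseteq> gate ` insert t S" using s gate_id[OF t(1)] by force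
  have sub: "insert t S \<subseteq> V" using t(1) p_V SV by blast
  have "pins_dist_diff (insert t S) (set p)"
    unfolding pins_dist_diff_def
  proof (intro ballI impI)
    fix u v x w
    assume uv: "u \<in> V" "v \<in> V" and unres: "\<forall>s\<in>insert t S. dist_diff u v s = 0"
      and xw: "x \<in> set p" "w \<in> set p"
    have "gate u = gate v"
      by (rule gate_eq_if_unresolved[OF uv sub _ X _ _ s(3) t(2)]) (use unres in auto)
    then show "dist_diff u v x = dist_diff u v w"
      using dist_diff_on_cycle[OF uv] xw by (simp add: dist_diff_def)
  qed
  then show ?thesis using t(1) p_V by blast
qed

end

section \<open>The number of cycles of a cactus\<close>

context connected_simple_graph
begin

lemma card_V_le_Suc_card_E: "card V \<le> Suc (card E)"
proof -
  obtain r where r: "r \<in> V" using conn by (auto simp: connected_graph_def)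
  have "\<exists>w. adj E v w \<and> d v r = Suc (d w r)" if "v \<in> V - {r}" for v
    using adj_closer[of v r] that r by blast
  then obtain parent where
    parent: "\<And>v. v \<in> V - {r} \<Longrightarrow> adj E v (parent v) \<and> d v r = Suc (d (parent v) r)"
    by metis
  have "inj_on (\<lambda>v. {v, parent v}) (V - {r})"
  proof (rule inj_onI)
    fix v w assume vw: "v \<in> V - {r}" "w \<in> V - {r}" and "{v, parent v} = {w, parent w}"
    then have "v = w \<or> v = parent w \<and> w = parent v" by (auto simp: doubleton_eq_iff)
    then show "v = w" using parent[OF vw(1)] parent[OF vw(2)] by auto
  qed
  then have "card (V - {r}) \<le> card E"
    using parent finite_E by (intro card_inj_on_le[of "\<lambda>v. {v, parent v}"]) auto
  then show ?thesis using r finite_V by (simp add: card_Diff_singleton)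
qed

lemma card_le_cycle_rank_if_bypassed:
  assumes D: "D \<subseteq> E" and bypass: "\<And>x y. {x, y} \<in> D \<Longrightarrow> reachable (E - D) x y"
  shows "int (card D) \<le> cycle_rank V E"
proof -
  have edge: "reachable (E - D) x y" if "adj E x y" for x y
    using that bypass by (cases "{x, y} \<in> D") auto
  have reach: "reachable (E - D) x y" if "reachable E x y" for x y
    using that
  proof (induction rule: rtranclp_induct)
    case (step y z)
    show ?case by (rule rtranclp_trans[OF step.IH edge[OF step.hyps(2)]])
  qed simp
  have sub: "\<Union> (E - D) \<subseteq> V" using Union_E_subset by blast
  interpret remaining: connected_simple_graph V "E - D"
  proof
    show "finite_simple_graph V (E - D)" using graph by (simp add: finite_simple_graph_def)
    show "connected_graph V (E - D)"
      unfolding connected_graph_iff_reachable[OF sub]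
      using conn reach reachable_E by (auto simp: connected_graph_def)
  qed
  have "card (E - D) = card E - card D" "card D \<le> card E"
    using D finite_E by (auto simp: card_Diff_subset finite_subset intro: card_mono)
  then show ?thesis
    using remaining.card_V_le_Suc_card_E unfolding cycle_rank_def by linarith
qed

definition cycles :: "'a set set set" where
  "cycles = cycle_edges ` {p. is_cycle V E p}"

lemma finite_cycles: "finite cycles"
  by (rule finite_subset[of _ "Pow E"]) (auto simp: cycles_def is_cycle_def finite_E)

lemma card_cycles_le_cycle_rank:
  assumes cactus: "cactus V E"
  shows "int (card cycles) \<le> cycle_rank V E"
proof -
  have "\<forall>C\<in>cycles. \<exists>p. is_cycle V E p \<and> cycle_edges p = C" by (auto simp: cycles_def)
  then obtain rep where rep: "\<And>C. C \<in> cycles \<Longrightarrow> is_cycle V E (rep C) \<and> cycle_edges (rep C) = C"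
    by metis
  define closing where "closing C = {last (rep C), hd (rep C)}" for C
  have disjoint: "C = C'" if "C \<in> cycles" "C' \<in> cycles" "e \<in> C" "e \<in> C'" for C C' e
    using cactus_cycle_edges_eq[OF cactus] that unfolding cycles_def by blast
  have rep_ne: "rep C \<noteq> []" if "C \<in> cycles" for C
    using rep[OF that] by (auto simp: is_cycle_def)
  have closing: "closing C \<in> C" if "C \<in> cycles" for C
    using closing_edge_in_cycle_edges[OF rep_ne[OF that]] rep[OF that] by (simp add: closing_def)
  have subset_E: "C \<subseteq> E" if "C \<in> cycles" for C
    using rep[OF that] by (auto simp: is_cycle_def)
  have "inj_on closing cycles" using closing disjoint by (metis inj_onI)
  then have "card cycles = card (closing ` cycles)" by (simp add: card_image)
  moreover have "int (card (closing ` cycles)) \<le> cycle_rank V E"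
  proof (rule card_le_cycle_rank_if_bypassed)
    let ?F = "E - closing ` cycles"
    show "closing ` cycles \<subseteq> E" using closing subset_E by blast
    fix x y assume "{x, y} \<in> closing ` cycles"
    then obtain C where C: "C \<in> cycles" "{x, y} = closing C" by blast
    have "C - {closing C} \<subseteq> ?F" using closing disjoint subset_E C(1) by blast
    moreover have "successively (adj (C - {closing C})) (rep C)"
      using successively_cycle_edges_minus_closing[of "rep C"] rep[OF C(1)]
      by (simp add: is_cycle_def closing_def)
    ultimately have "is_path V ?F (hd (rep C)) (rep C) (last (rep C))"
      using rep[OF C(1)] rep_ne[OF C(1)]
      by (auto simp: is_path_def is_cycle_def elim!: successively_mono)
    then have around: "reachable ?F (hd (rep C)) (last (rep C))"
      by (rule relpowp_imp_rtranclp[OF is_path_imp_relpowp])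
    have "x = hd (rep C) \<and> y = last (rep C) \<or> x = last (rep C) \<and> y = hd (rep C)"
      using C(2) by (auto simp: closing_def doubleton_eq_iff)
    then show "reachable ?F x y" using around reachable_sym[OF around] by blast
  qed
  ultimately show ?thesis by simp
qed

lemma resolving_set_if_zero_forcing_set:
  assumes cactus: "cactus V E" and S: "zero_forcing_set V E S"
  obtains T where "resolving_set V E (S \<union> T)" "card T \<le> card cycles"
proof -
  have "\<exists>t\<in>V. pins_dist_diff (insert t S) (\<Union> C)" if C: "C \<in> cycles" for C
  proof -
    obtain p where p: "is_cycle V E p" "C = cycle_edges p" using C by (auto simp: cycles_def)
    interpret cactus_cycle V E p using cactus p(1) by unfold_locales
    show ?thesis unfolding p(2) Union_cycle_edges by (rule pins_dist_diff_insert_cycle_vertex[OF S])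
  qed
  then obtain t where t: "\<And>C. C \<in> cycles \<Longrightarrow> t C \<in> V \<and> pins_dist_diff (insert (t C) S) (\<Union> C)"
    by metis
  have "resolving_set V E (S \<union> t ` cycles)"
  proof (rule resolving_set_if_pins_dist_diff[OF S])
    show "S \<union> t ` cycles \<subseteq> V" using S t by (auto simp: zero_forcing_set_def)
    fix p assume "is_cycle V E p"
    then have C: "cycle_edges p \<in> cycles" by (simp add: cycles_def)
    then have "pins_dist_diff (insert (t (cycle_edges p)) S) (set p)"
      using t unfolding Union_cycle_edges[symmetric] by blast
    then show "pins_dist_diff (S \<union> t ` cycles) (set p)"
      by (rule pins_dist_diff_mono) (use C in blast)
  qed simp
  moreover have "card (t ` cycles) \<le> card cycles" using finite_cycles by (rule card_image_le)
  ultimately show ?thesis using that by blast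
qed

end

section \<open>The metric dimension of a cactus\<close>

lemma metric_dimension_le: "resolving_set V E S \<Longrightarrow> metric_dimension V E \<le> card S"
  unfolding metric_dimension_def by (rule Least_le) blast

lemma zero_forcing_number_attained:
  obtains S where "zero_forcing_set V E S" "card S = zero_forcing_number V E"
proof -
  have "zero_forcing_set V E V" by (simp add: zero_forcing_set_def)
  then have "\<exists>k S. zero_forcing_set V E S \<and> card S = k" by blast
  then have "\<exists>S. zero_forcing_set V E S \<and> card S = zero_forcing_number V E"
    unfolding zero_forcing_number_def by (rule LeastI_ex)
  then show ?thesis using that by blast
qed

theorem theorem3:
  fixes V :: "'a set" and E :: "'a set set"
  assumes "finite_simple_graph V E"
    and "connected_graph V E"
    and "cactus V E"
  shows "int (metric_dimension V E) \<le> cycle_rank V E + int (zero_forcing_number V E)"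
proof -
  interpret connected_simple_graph V E using assms(1,2) by unfold_locales
  obtain S where S: "zero_forcing_set V E S" "card S = zero_forcing_number V E"
    by (rule zero_forcing_number_attained)
  obtain T where T: "resolving_set V E (S \<union> T)" "card T \<le> card cycles"
    by (rule resolving_set_if_zero_forcing_set[OF assms(3) S(1)])
  have "metric_dimension V E \<le> card (S \<union> T)" using T(1) by (rule metric_dimension_le)
  also have "\<dots> \<le> zero_forcing_number V E + card cycles"
    using card_Un_le[of S T] T(2) S(2) by simp
  finally show ?thesis using card_cycles_le_cycle_rank[OF assms(3)] by linarith
qed

end
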